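(* The target discounted-sum problem reduces to the problem of deciding whether $\mathsf{CSV}(v)\ge c$ in discounted-sum games. That is, there is a computable map which sends each instance $I=(a,b,t,\lambda)$ of the target discounted-sum problem to a discounted-sum game, a vertex $v$ of it and a threshold $c\in\mathbb{Q}$, such that $I$ is a positive instance if and only if $\mathsf{CSV}(v)\ge c$ in this game.
   Context: Target discounted-sum problem: given a rational discount factor $0<\lambda<1$ and three rationals $a,b,t$, does there exist an infinite sequence $w\in\{a,b\}^\omega$ such that $\sum_{i=0}^\infty w(i)\lambda^i=t$? A (bi-weighted) arena $\mathcal{A}=(V,E,\langle V_0,V_1\rangle,w_0,w_1)$ consists of a finite set $V$ of vertices, a set $E\subseteq V\times V$ of edges such that every vertex has at least one outgoing edge, a partition $\langle V_0,V_1\rangle$ of $V$ ($V_i$ is owned by Player $i$), and two weight functions $w_0,w_1:E\to\mathbb{Z}$. A play is an infinite path $\pi=\pi_0\pi_1\dots$ of the arena; a history is a non-empty finite prefix of a play. Discounted-sum game with discount factor $0<\lambda<1$: the payoff of Player $i\in\{0,1\}$ for a play $\pi$ is $\mathsf{DS}_i^\lambda(\pi)=\sum_{k=0}^\infty\lambda^k w_i(\pi_k,\pi_{k+1})$. A strategy of Player $i$ is a function mapping each history ending in a vertex $u\in V_i$ to a successor of $u$; $\Sigma_i$ is the set of all strategies of Player $i$. For $v\in V$, $\mathsf{Out}_v(\sigma_0,\sigma_1)$ is the unique play starting in $v$ in which both players follow their strategies. Best-responses of Player 1 to $\sigma_0$: $\mathsf{BR}_1(\sigma_0)=\{\sigma_1\in\Sigma_1\mid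 \forall v\in V\ \forall\sigma_1'\in\Sigma_1:\ \mathsf{DS}_1^\lambda(\mathsf{Out}_v(\sigma_0,\sigma_1))\ge\mathsf{DS}_1^\lambda(\mathsf{Out}_v(\sigma_0,\sigma_1'))\}$ (this set is always non-empty). Cooperative Stackelberg value: $\mathsf{CSV}(\sigma_0)(v)=\sup_{\sigma_1\in\mathsf{BR}_1(\sigma_0)}\mathsf{DS}_0^\lambda(\mathsf{Out}_v(\sigma_0,\sigma_1))$ and $\mathsf{CSV}(v)=\sup_{\sigma_0\in\Sigma_0}\mathsf{CSV}(\sigma_0)(v)$. *)

theory Defs
  imports
    Complex_Main
    "HOL-Library.FuncSet"
    "HOL-Library.Extended_Real"
    "HOL-Library.Nat_Bijection"
begin

section \<open>Computable functions\<close>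

text \<open>
  The library has no notion of computability, so we take Kleene's partial recursive functions.
  The relation \<open>computes p xs y\<close> says that program \<open>p\<close>, run on the arguments \<open>xs\<close>, halts with
  result \<open>y\<close>. In rule \<open>PMin\<close> the search only succeeds if \<open>f\<close> converges to a positive value at
  every candidate below \<open>n\<close>.
\<close>

datatype prog = PZero | PSucc | PProj nat | PComp prog "prog list" | PRec prog prog | PMin prog

inductive computes :: "prog \<Rightarrow> nat list \<Rightarrow> nat \<Rightarrow> bool" where
  PZero: "computes PZero xs 0"
| PSucc: "computes PSucc [x] (Suc x)"
| PProj: "i < length xs \<Longrightarrow> computes (PProj i) xs (xs ! i)"
| PComp: "list_all2 (\<lambda>g y. computes g xs y) gs ys \<Longrightarrow> computes f ys z \<Longrightarrow> computes (PComp f gs) xs z"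
| PRec0: "computes f xs y \<Longrightarrow> computes (PRec f g) (0 # xs) y"
| PRecSuc: "computes (PRec f g) (n # xs) y \<Longrightarrow> computes g (n # y # xs) z \<Longrightarrow> computes (PRec f g) (Suc n # xs) z"
| PMin:  "computes f (n # xs) 0 \<Longrightarrow> (\<forall>i<n. \<exists>y. computes f (i # xs) (Suc y)) \<Longrightarrow> computes (PMin f) xs n"

inductive_cases computes_PZeroE: "computes PZero xs y"
inductive_cases computes_PSuccE: "computes PSucc xs y"
inductive_cases computes_PProjE: "computes (PProj i) xs y"
inductive_cases computes_PCompE: "computes (PComp f gs) xs y"
inductive_cases computes_PRec0E: "computes (PRec f g) (0 # xs) y"
inductive_cases computes_PRecSucE: "computes (PRec f g) (Suc n # xs) y"
inductive_cases computes_PMinE: "computes (PMin f) xs y"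

lemma computes_deterministic: "computes p xs y \<Longrightarrow> computes p xs y' \<Longrightarrow> y = y'"
proof (induction arbitrary: y' rule: computes.induct)
  case (PComp xs gs ys f z)
  from PComp.prems obtain ys' where ys': "list_all2 (\<lambda>g y. computes g xs y) gs ys'" "computes f ys' y'"
    by (auto elim: computes_PCompE)
  have "ys = ys'"
    using PComp.IH(1) ys'(1) by (auto simp: list_all2_conv_all_nth intro!: nth_equalityI)
  then show ?case using PComp.IH(2) ys'(2) by blast
next
  case (PRecSuc f g n xs y z)
  from PRecSuc.prems obtain u where "computes (PRec f g) (n # xs) u" "computes g (n # u # xs) y'"
    by (auto elim: computes_PRecSucE)
  then show ?case using PRecSuc.IH by blast
next
  case (PMin f n xs)
  from PMin.prems have m: "computes f (y' # xs) 0" "\<forall>i<y'. \<exists>y. computes f (i # xs) (Suc y)"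
    by (auto elim: computes_PMinE)
  show ?case
  proof (rule linorder_cases[of n y'])
    assume "n < y'"
    then show ?thesis using m(2) PMin.IH(1) by blast
  next
    assume "y' < n"
    then show ?thesis using m(1) PMin.IH(2) by blast
  qed simp
next
  case (PZero xs)
  then show ?case by (blast elim: computes_PZeroE)
next
  case (PSucc x)
  then show ?case by (blast elim: computes_PSuccE)
next
  case (PProj i xs)
  then show ?case by (blast elim: computes_PProjE)
next
  case (PRec0 f xs y g)
  then show ?case by (blast elim: computes_PRec0E)
qed

text \<open>
  Functions between other countable types are computable relative to injective encodings of their
  elements as numbers. The program may behave arbitrarily on numbers that do not encode an element
  of \<open>D\<close>.
\<close>

definition computable_on :: "'a set \<Rightarrow> ('a \<Rightarrow> nat) \<Rightarrow> ('b \<Rightarrow> nat) \<Rightarrow> ('a \<Rightarrow> 'b) \<Rightarrow> bool" where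
  "computable_on D enc enc' f \<longleftrightarrow> (\<exists>p. \<forall>x\<in>D. computes p [enc x] (enc' (f x)))"


section \<open>Arenas, strategies and outcomes\<close>

datatype player = Player0 | Player1

record 'v arena =
  verts :: "'v set"
  edges :: "('v \<times> 'v) set"
  own   :: "player \<Rightarrow> 'v set"
  wt    :: "player \<Rightarrow> 'v \<times> 'v \<Rightarrow> int"

definition valid_arena :: "'v arena \<Rightarrow> bool" where
  "valid_arena A \<longleftrightarrow>
     finite (verts A) \<and> edges A \<subseteq> verts A \<times> verts A \<and>
     (\<forall>u\<in>verts A. \<exists>v. (u, v) \<in> edges A) \<and>
     own A Player0 \<union> own A Player1 = verts A \<and> own A Player0 \<inter> own A Player1 = {}"

definition plays :: "'v arena \<Rightarrow> (nat \<Rightarrow> 'v) set" where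
  "plays A = {\<pi>. \<forall>k. (\<pi> k, \<pi> (Suc k)) \<in> edges A}"

definition histories :: "'v arena \<Rightarrow> 'v list set" where
  "histories A = {map \<pi> [0..<n] | \<pi> n. \<pi> \<in> plays A \<and> n > 0}"

definition DS :: "'v arena \<Rightarrow> real \<Rightarrow> player \<Rightarrow> (nat \<Rightarrow> 'v) \<Rightarrow> real" where
  "DS A lam i \<pi> = (\<Sum>k. lam ^ k * of_int (wt A i (\<pi> k, \<pi> (Suc k))))"

text \<open>
  Strategies are total functions in HOL; their values outside the histories of their owner are
  unconstrained and never consulted.
\<close>

definition strategies :: "'v arena \<Rightarrow> player \<Rightarrow> ('v list \<Rightarrow> 'v) set" where
  "strategies A i = (\<Pi> h\<in>{h\<in>histories A. last h \<in> own A i}. {u. (last h, u) \<in> edges A})"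

definition consistent :: "'v arena \<Rightarrow> player \<Rightarrow> ('v list \<Rightarrow> 'v) \<Rightarrow> (nat \<Rightarrow> 'v) \<Rightarrow> bool" where
  "consistent A i \<sigma> \<pi> \<longleftrightarrow> (\<forall>k. \<pi> k \<in> own A i \<longrightarrow> \<pi> (Suc k) = \<sigma> (map \<pi> [0..<Suc k]))"

definition Out :: "'v arena \<Rightarrow> 'v \<Rightarrow> ('v list \<Rightarrow> 'v) \<Rightarrow> ('v list \<Rightarrow> 'v) \<Rightarrow> nat \<Rightarrow> 'v" where
  "Out A v \<sigma>0 \<sigma>1 =
     (THE \<pi>. \<pi> \<in> plays A \<and> \<pi> 0 = v \<and> consistent A Player0 \<sigma>0 \<pi> \<and> consistent A Player1 \<sigma>1 \<pi>)"

lemma finite_path_history: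
  assumes A: "valid_arena A" and v: "\<pi> n \<in> verts A"
    and path: "\<And>k. k < n \<Longrightarrow> (\<pi> k, \<pi> (Suc k)) \<in> edges A"
  shows "map \<pi> [0..<Suc n] \<in> histories A"
proof -
  define s where "s u = (SOME w. (u, w) \<in> edges A)" for u
  have s: "(u, s u) \<in> edges A" if "u \<in> verts A" for u
    using A that unfolding s_def valid_arena_def by (metis (mono_tags, lifting) someI_ex)
  have sv: "(s ^^ k) (\<pi> n) \<in> verts A" for k
    by (induction k) (use A v s in \<open>auto simp: valid_arena_def\<close>)
  define \<rho> where "\<rho> k = (if k \<le> n then \<pi> k else (s ^^ (k - n)) (\<pi> n))" for k
  have "(\<rho> k, \<rho> (Suc k)) \<in> edges A" for k
  proof -
    consider "k < n" | "k = n" | "k > n" by linarith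
    then show ?thesis
      using path s sv v by cases (auto simp: \<rho>_def Suc_diff_le)
  qed
  then have "\<rho> \<in> plays A" by (simp add: plays_def)
  moreover have "map \<pi> [0..<Suc n] = map \<rho> [0..<Suc n]" by (auto simp: \<rho>_def)
  ultimately show ?thesis unfolding histories_def by blast
qed

lemma Out_ex1:
  assumes A: "valid_arena A" and v: "v \<in> verts A"
    and \<sigma>: "\<sigma>0 \<in> strategies A Player0" "\<sigma>1 \<in> strategies A Player1"
  shows "\<exists>!\<pi>. \<pi> \<in> plays A \<and> \<pi> 0 = v \<and> consistent A Player0 \<sigma>0 \<pi> \<and> consistent A Player1 \<sigma>1 \<pi>"
proof -
  define s where "s h = (if last h \<in> own A Player0 then \<sigma>0 h else \<sigma>1 h)" for h
  define H where "H n = ((\<lambda>h. h @ [s h]) ^^ n) [v]" for n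
  define \<pi> where "\<pi> n = last (H n)" for n
  have HS: "H (Suc n) = H n @ [s (H n)]" for n by (simp add: H_def)
  have \<pi>S: "\<pi> (Suc n) = s (H n)" for n by (simp add: \<pi>_def HS)
  have H: "map \<pi> [0..<Suc n] = H n" for n
  proof (induction n)
    case 0
    show ?case by (simp add: \<pi>_def H_def)
  next
    case (Suc n)
    then show ?case by (simp add: HS \<pi>S)
  qed
  have cov: "u \<in> own A Player0 \<or> u \<in> own A Player1" if "u \<in> verts A" for u
    using A that by (auto simp: valid_arena_def)
  have disj: "u \<notin> own A Player1" if "u \<in> own A Player0" for u
    using A that by (auto simp: valid_arena_def)
  have step: "(\<pi> n, \<pi> (Suc n)) \<in> edges A"
    if "\<pi> n \<in> verts A" "\<And>k. k < n \<Longrightarrow> (\<pi> k, \<pi> (Suc k)) \<in> edges A" for n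
  proof -
    have "H n \<in> histories A" using finite_path_history[OF A that] H by simp
    moreover have "last (H n) = \<pi> n" by (simp add: \<pi>_def)
    ultimately show ?thesis
      using \<sigma> cov[OF that(1)] by (auto simp: strategies_def \<pi>S s_def Pi_iff)
  qed
  have all: "\<pi> n \<in> verts A \<and> (\<forall>k<n. (\<pi> k, \<pi> (Suc k)) \<in> edges A)" for n
  proof (induction n)
    case 0
    show ?case using v by (simp add: \<pi>_def H_def)
  next
    case (Suc n)
    then have "(\<pi> n, \<pi> (Suc n)) \<in> edges A" using step by blast
    then show ?case using Suc A by (auto simp: valid_arena_def less_Suc_eq)
  qed
  show ?thesis
  proof (rule ex1I[of _ \<pi>], intro conjI)
    show "\<pi> \<in> plays A" using all by (auto simp: plays_def)
    show "\<pi> 0 = v" by (simp add: \<pi>_def H_def)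
    show "consistent A Player0 \<sigma>0 \<pi>"
      unfolding consistent_def H \<pi>S s_def by (simp add: \<pi>_def)
    show "consistent A Player1 \<sigma>1 \<pi>"
      unfolding consistent_def H \<pi>S s_def using disj by (auto simp: \<pi>_def)
  next
    fix \<rho>
    assume \<rho>: "\<rho> \<in> plays A \<and> \<rho> 0 = v \<and> consistent A Player0 \<sigma>0 \<rho> \<and> consistent A Player1 \<sigma>1 \<rho>"
    have "map \<rho> [0..<Suc n] = H n" for n
    proof (induction n)
      case 0
      show ?case using \<rho> by (simp add: H_def)
    next
      case (Suc n)
      have l: "last (H n) = \<rho> n" by (simp flip: Suc)
      have "\<rho> n \<in> verts A" using \<rho> A by (auto simp: plays_def valid_arena_def)
      then have "\<rho> (Suc n) = s (H n)"
        using cov[of "\<rho> n"] disj[of "\<rho> n"] \<rho> Suc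
        by (auto simp: consistent_def s_def l simp del: upt_Suc)
      then show ?case using Suc by (simp add: HS)
    qed
    then have "map \<rho> [0..<Suc n] = map \<pi> [0..<Suc n]" for n using H by simp
    then show "\<rho> = \<pi>" by (auto simp: fun_eq_iff)
  qed
qed


section \<open>Best responses and the cooperative Stackelberg value\<close>

definition BR1 :: "'v arena \<Rightarrow> real \<Rightarrow> ('v list \<Rightarrow> 'v) \<Rightarrow> ('v list \<Rightarrow> 'v) set" where
  "BR1 A lam \<sigma>0 =
     {\<sigma>1\<in>strategies A Player1. \<forall>v\<in>verts A. \<forall>\<sigma>1'\<in>strategies A Player1.
        DS A lam Player1 (Out A v \<sigma>0 \<sigma>1) \<ge> DS A lam Player1 (Out A v \<sigma>0 \<sigma>1')}"

text \<open>
  The suprema are taken in the extended reals, where they always exist. For \<open>0 < lam < 1\<close> payoffs are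
  bounded and best responses exist, so the values are the real suprema.
\<close>

definition CSV_strat :: "'v arena \<Rightarrow> real \<Rightarrow> ('v list \<Rightarrow> 'v) \<Rightarrow> 'v \<Rightarrow> ereal" where
  "CSV_strat A lam \<sigma>0 v = (SUP \<sigma>1\<in>BR1 A lam \<sigma>0. ereal (DS A lam Player0 (Out A v \<sigma>0 \<sigma>1)))"

definition CSV :: "'v arena \<Rightarrow> real \<Rightarrow> 'v \<Rightarrow> ereal" where
  "CSV A lam v = (SUP \<sigma>0\<in>strategies A Player0. CSV_strat A lam \<sigma>0 v)"


section \<open>The two decision problems\<close>

text \<open>Rationals are coded by their fraction in lowest terms with positive denominator.\<close>

definition encode_rat :: "rat \<Rightarrow> nat" where
  "encode_rat r = (case quotient_of r of (p, q) \<Rightarrow> prod_encode (int_encode p, nat q))"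

lemma inj_encode_rat: "inj encode_rat"
proof (rule injI)
  fix r s assume *: "encode_rat r = encode_rat s"
  obtain p q where r: "quotient_of r = (p, q)" by force
  obtain p' q' where s: "quotient_of s = (p', q')" by force
  have "q > 0" "q' > 0" using quotient_of_denom_pos r s by auto
  then have "quotient_of r = quotient_of s"
    using * r s by (auto simp: encode_rat_def prod_encode_eq int_encode_eq)
  then show "r = s" by (simp add: quotient_of_inject)
qed

text \<open>An instance \<open>(a, b, t, lam)\<close> of the target discounted-sum problem.\<close>

type_synonym target_instance = "rat \<times> rat \<times> rat \<times> rat"

definition target_instances :: "target_instance set" where
  "target_instances = {(a, b, t, lam). 0 < lam \<and> lam < 1}"

definition target_positive :: "target_instance \<Rightarrow> bool" where
  "target_positive = (\<lambda>(a, b, t, lam).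
     \<exists>w :: nat \<Rightarrow> rat. (\<forall>i. w i \<in> {a, b}) \<and> (\<lambda>i. of_rat (w i) * of_rat lam ^ i) sums (of_rat t :: real))"

definition encode_target :: "target_instance \<Rightarrow> nat" where
  "encode_target = (\<lambda>(a, b, t, lam).
     list_encode [encode_rat a, encode_rat b, encode_rat t, encode_rat lam])"

lemma inj_encode_target: "inj encode_target"
  by (auto simp: inj_def encode_target_def list_encode_eq inj_eq[OF inj_encode_rat])

text \<open>
  Finite presentations of discounted-sum games. The vertices are \<open>0, \<dots>, n - 1\<close>, where \<open>n\<close> is the
  length of the list of owners; the edges with the pair of their weights \<open>(w\<^sub>0, w\<^sub>1)\<close> form an
  association list.
\<close>

record ds_game =
  owners   :: "player list"
  edge_wts :: "((nat \<times> nat) \<times> (int \<times> int)) list"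
  discount :: rat

definition arena_of :: "ds_game \<Rightarrow> nat arena" where
  "arena_of G =
     \<lparr> verts = {..<length (owners G)},
       edges = fst ` set (edge_wts G),
       own = (\<lambda>i. {v. v < length (owners G) \<and> owners G ! v = i}),
       wt = (\<lambda>i e. case the (map_of (edge_wts G) e) of
                      (x, y) \<Rightarrow> (case i of Player0 \<Rightarrow> x | Player1 \<Rightarrow> y)) \<rparr>"

definition valid_game :: "ds_game \<Rightarrow> bool" where
  "valid_game G \<longleftrightarrow>
     valid_arena (arena_of G) \<and> distinct (map fst (edge_wts G)) \<and> 0 < discount G \<and> discount G < 1"

text \<open>An instance \<open>(G, v, c)\<close> of the threshold problem for the cooperative Stackelberg value.\<close>

type_synonym csv_instance = "ds_game \<times> nat \<times> rat"

definition csv_instances :: "csv_instance set" where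
  "csv_instances = {(G, v, c). valid_game G \<and> v \<in> verts (arena_of G)}"

definition csv_positive :: "csv_instance \<Rightarrow> bool" where
  "csv_positive = (\<lambda>(G, v, c). CSV (arena_of G) (of_rat (discount G)) v \<ge> ereal (of_rat c))"

definition encode_player :: "player \<Rightarrow> nat" where
  "encode_player i = (case i of Player0 \<Rightarrow> 0 | Player1 \<Rightarrow> 1)"

definition encode_edge :: "(nat \<times> nat) \<times> (int \<times> int) \<Rightarrow> nat" where
  "encode_edge = (\<lambda>((u, v), (x, y)). list_encode [u, v, int_encode x, int_encode y])"

definition encode_game :: "ds_game \<Rightarrow> nat" where
  "encode_game G = list_encode
     [list_encode (map encode_player (owners G)),
      list_encode (map encode_edge (edge_wts G)),
      encode_rat (discount G)]"

definition encode_csv :: "csv_instance \<Rightarrow> nat" where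
  "encode_csv = (\<lambda>(G, v, c). list_encode [encode_game G, v, encode_rat c])"

lemma inj_encode_csv: "inj encode_csv"
proof -
  have p: "inj encode_player"
    by (auto simp: inj_def encode_player_def split: player.splits)
  have e: "inj encode_edge"
    by (auto simp: inj_def encode_edge_def list_encode_eq int_encode_eq)
  have "inj encode_game"
    by (auto simp: inj_def encode_game_def list_encode_eq inj_eq[OF inj_encode_rat]
        inj_map_eq_map[OF p] inj_map_eq_map[OF e])
  then show ?thesis
    by (auto simp: inj_def encode_csv_def list_encode_eq inj_eq[OF inj_encode_rat])
qed

end

theory Submission
  imports Defs
begin

text \<open>
  Player 0 emits the digits of a word \<open>w\<close>, and the payoffs of the two players are, up to a common
  factor, the value of \<open>w\<close> and its negative. Before that, Player 1 may leave with the payoff that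
  corresponds to the value \<open>t\<close>, which gives Player 0 less than the threshold. So Player 1
  cooperates only with words of value at most \<open>t\<close>, and the cooperative Stackelberg value reaches
  the threshold iff \<open>t\<close> is the supremum of the values of such words. As the set of values of words
  is closed, \<open>t\<close> is then attained.
\<close>


section \<open>Computable functions on lists of numbers\<close>

text \<open>One program must halt with the right value on every list of length \<open>n\<close>;
  other lengths are unconstrained. Because functions act on the whole argument list, the closure
  rules collected in \<open>rf_intros\<close> follow the syntax of a term.\<close>

definition recursive_fun :: "nat \<Rightarrow> (nat list \<Rightarrow> nat) \<Rightarrow> bool" where
  "recursive_fun n f \<longleftrightarrow> (\<exists>p. \<forall>xs. length xs = n \<longrightarrow> computes p xs (f xs))"

named_theorems rf_intros

lemma rf_cong:
  assumes "recursive_fun n f" "\<And>xs. length xs = n \<Longrightarrow> f xs = g xs"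
  shows "recursive_fun n g"
  using assms by (metis recursive_fun_def)

lemma rf_nth [rf_intros]: "i < n \<Longrightarrow> recursive_fun n (\<lambda>xs. xs ! i)"
  unfolding recursive_fun_def by (metis computes.PProj)

lemma rf_comp:
  assumes f: "recursive_fun (length gs) f" and gs: "\<And>g. g \<in> set gs \<Longrightarrow> recursive_fun n g"
  shows "recursive_fun n (\<lambda>xs. f (map (\<lambda>g. g xs) gs))"
proof -
  obtain p where p: "\<And>ys. length ys = length gs \<Longrightarrow> computes p ys (f ys)"
    using f by (auto simp: recursive_fun_def)
  obtain q where q: "\<And>g xs. g \<in> set gs \<Longrightarrow> length xs = n \<Longrightarrow> computes (q g) xs (g xs)"
    using gs unfolding recursive_fun_def by metis
  have "computes (PComp p (map q gs)) xs (f (map (\<lambda>g. g xs) gs))" if "length xs = n" for xs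
    by (rule computes.PComp[of _ _ "map (\<lambda>g. g xs) gs"])
      (use that in \<open>auto simp: list_all2_conv_all_nth intro!: p q\<close>)
  then show ?thesis by (auto simp: recursive_fun_def)
qed

text \<open>The step function of a recursion receives the counter and the previous value in front of
  the parameters. Dropping these two lets it evaluate a function of the original arguments.\<close>

lemma rf_drop:
  assumes "recursive_fun n f"
  shows "recursive_fun (Suc (Suc n)) (\<lambda>ys. f (drop 2 ys))"
proof -
  have "recursive_fun (Suc (Suc n)) (\<lambda>ys. f (map (\<lambda>g. g ys) (map (\<lambda>i ys. ys ! (i + 2)) [0..<n])))"
    by (rule rf_comp) (use assms in \<open>auto intro!: rf_nth\<close>)
  moreover have "map (\<lambda>g. g ys) (map (\<lambda>i ys. ys ! (i + 2)) [0..<n]) = drop 2 ys"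
    if "length ys = Suc (Suc n)" for ys :: "nat list"
    by (rule nth_equalityI) (use that in auto)
  ultimately show ?thesis by (auto elim!: rf_cong)
qed

lemma rf_0 [rf_intros]: "recursive_fun n (\<lambda>xs. 0)"
  unfolding recursive_fun_def by (metis computes.PZero)

lemma rf_Suc [rf_intros]:
  assumes "recursive_fun n f"
  shows "recursive_fun n (\<lambda>xs. Suc (f xs))"
proof -
  have "computes PSucc xs (Suc (xs ! 0))" if "length xs = 1" for xs
    using that by (cases xs) (auto intro: computes.PSucc)
  then have "recursive_fun 1 (\<lambda>xs. Suc (xs ! 0))" unfolding recursive_fun_def by blast
  with assms have "recursive_fun n (\<lambda>xs. Suc (map (\<lambda>g. g xs) [f] ! 0))"
    by (intro rf_comp) auto
  then show ?thesis by simp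
qed

text \<open>\<open>PRec\<close> recurses on the head of its argument list. Composing it with
  \<open>c\<close> followed by all projections makes \<open>c xs\<close> the recursion depth and
  keeps \<open>xs\<close> as parameters.\<close>

lemma rf_rec:
  assumes b: "recursive_fun n b" and s: "recursive_fun (Suc (Suc n)) s" and c: "recursive_fun n c"
  shows "recursive_fun n (\<lambda>xs. rec_nat (b xs) (\<lambda>i r. s (i # r # xs)) (c xs))"
proof -
  obtain p where p: "\<And>xs. length xs = n \<Longrightarrow> computes p xs (b xs)"
    using b by (auto simp: recursive_fun_def)
  obtain q where q: "\<And>xs. length xs = Suc (Suc n) \<Longrightarrow> computes q xs (s xs)"
    using s by (auto simp: recursive_fun_def)
  let ?r = "\<lambda>m xs. rec_nat (b xs) (\<lambda>i r. s (i # r # xs)) m"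
  have r: "computes (PRec p q) (m # xs) (?r m xs)" if "length xs = n" for m xs
    by (induction m) (use that in \<open>auto intro!: computes.PRec0 computes.PRecSuc p q\<close>)
  have "computes (PRec p q) xs (?r (hd xs) (tl xs))" if "length xs = Suc n" for xs
    using that r by (cases xs) auto
  then have "recursive_fun (length (c # map (\<lambda>i xs. xs ! i) [0..<n])) (\<lambda>xs. ?r (hd xs) (tl xs))"
    by (auto simp: recursive_fun_def)
  then have "recursive_fun n
    (\<lambda>xs. ?r (hd (map (\<lambda>g. g xs) (c # map (\<lambda>i xs. xs ! i) [0..<n])))
              (tl (map (\<lambda>g. g xs) (c # map (\<lambda>i xs. xs ! i) [0..<n]))))"
    by (rule rf_comp) (use c in \<open>auto intro: rf_nth\<close>)
  moreover have "map (\<lambda>g. g xs) (map (\<lambda>i xs. xs ! i) [0..<n]) = xs" if "length xs = n" for xs :: "nat list"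
    by (rule nth_equalityI) (use that in auto)
  ultimately show ?thesis by (auto elim!: rf_cong)
qed

section \<open>Arithmetic by primitive recursion\<close>

lemma rf_add [rf_intros]:
  assumes "recursive_fun n f" "recursive_fun n g"
  shows "recursive_fun n (\<lambda>xs. f xs + g xs)"
proof -
  have "recursive_fun n (\<lambda>xs. rec_nat (f xs) (\<lambda>i r. Suc ((i # r # xs) ! 1)) (g xs))"
    by (rule rf_rec[where s = "\<lambda>xs. Suc (xs ! 1)"]) (intro rf_intros assms | simp)+
  moreover have "rec_nat x (\<lambda>i. Suc) y = x + y" for x y by (induction y) auto
  ultimately show ?thesis by simp
qed

lemma rf_mult [rf_intros]:
  assumes "recursive_fun n f" "recursive_fun n g"
  shows "recursive_fun n (\<lambda>xs. f xs * g xs)"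
proof -
  have "recursive_fun n (\<lambda>xs. rec_nat 0 (\<lambda>i r. (i # r # xs) ! 1 + f (drop 2 (i # r # xs))) (g xs))"
    by (rule rf_rec[where s = "\<lambda>xs. xs ! 1 + f (drop 2 xs)"]) (intro rf_intros rf_drop assms | simp)+
  moreover have "rec_nat 0 (\<lambda>i r. r + x) y = x * y" for x y :: nat by (induction y) auto
  ultimately show ?thesis by simp
qed

lemma rf_diff [rf_intros]:
  assumes "recursive_fun n f" "recursive_fun n g"
  shows "recursive_fun n (\<lambda>xs. f xs - g xs)"
proof -
  \<comment> \<open>The predecessor is the counter of the last recursion step; truncated subtraction
    then iterates it.\<close>
  have pred: "recursive_fun m (\<lambda>xs. h xs - 1)" if "recursive_fun m h" for h m
  proof -
    have "recursive_fun m (\<lambda>xs. rec_nat 0 (\<lambda>i r. (i # r # xs) ! 0) (h xs))"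
      by (rule rf_rec[where s = "\<lambda>xs. xs ! 0"]) (intro rf_intros that | simp)+
    moreover have "rec_nat 0 (\<lambda>i r. i) y = y - 1" for y by (cases y) auto
    ultimately show ?thesis by simp
  qed
  have "recursive_fun n (\<lambda>xs. rec_nat (f xs) (\<lambda>i r. (i # r # xs) ! 1 - 1) (g xs))"
    by (rule rf_rec[where s = "\<lambda>xs. xs ! 1 - 1"]) (intro rf_intros pred assms | simp)+
  moreover have "rec_nat x (\<lambda>i r. r - Suc 0) y = x - y" for x y :: nat by (induction y) auto
  ultimately show ?thesis by simp
qed

lemma rf_const [rf_intros]: "recursive_fun n (\<lambda>xs. c)"
  by (induction c) (auto intro: rf_0 rf_Suc)


section \<open>Codes of pairs, lists, integers and rationals\<close>

lemma rf_triangle [rf_intros]: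
  assumes "recursive_fun n f"
  shows "recursive_fun n (\<lambda>xs. triangle (f xs))"
proof -
  have "recursive_fun n (\<lambda>xs. rec_nat 0 (\<lambda>i r. (i # r # xs) ! 1 + Suc ((i # r # xs) ! 0)) (f xs))"
    by (rule rf_rec[where s = "\<lambda>xs. xs ! 1 + Suc (xs ! 0)"]) (intro rf_intros assms | simp)+
  moreover have "rec_nat 0 (\<lambda>i r. Suc (r + i)) y = triangle y" for y by (induction y) auto
  ultimately show ?thesis by simp
qed

lemma rf_prod_encode [rf_intros]:
  "recursive_fun n f \<Longrightarrow> recursive_fun n g \<Longrightarrow> recursive_fun n (\<lambda>xs. prod_encode (f xs, g xs))"
  unfolding prod_encode_def prod.case by (intro rf_intros)

text \<open>The index of the antidiagonal on which the pair with code \<open>z\<close> lies.\<close>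

definition diag_index :: "nat \<Rightarrow> nat" where
  "diag_index = rec_nat 0 (\<lambda>i r. r + (1 - (triangle (Suc r) - Suc i)))"

text \<open>With truncated subtraction, \<open>1 - (x - y)\<close> is 1 if \<open>x \<le> y\<close>
  and 0 otherwise. So the recursion moves to the next antidiagonal exactly when the code reaches the
  next triangular number.\<close>

lemma diag_index_bounds: "triangle (diag_index z) \<le> z \<and> z < triangle (Suc (diag_index z))"
proof (induction z)
  case 0
  show ?case by (simp add: diag_index_def)
next
  case (Suc z)
  have step: "diag_index (Suc z) = diag_index z + (1 - (triangle (Suc (diag_index z)) - Suc z))"
    by (simp add: diag_index_def)
  show ?case
  proof (cases "triangle (Suc (diag_index z)) \<le> Suc z")
    case True
    with Suc have "triangle (Suc (diag_index z)) = Suc z" by linarith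
    moreover have "diag_index (Suc z) = Suc (diag_index z)" using True unfolding step by simp
    ultimately show ?thesis by (simp del: triangle_Suc add: triangle_Suc[of "Suc _"])
  next
    case False
    then have "diag_index (Suc z) = diag_index z" unfolding step by linarith
    then show ?thesis using Suc False by simp
  qed
qed

text \<open>The code of \<open>(x, y)\<close> is \<open>triangle (x + y) + x\<close>, which lies
  below \<open>triangle (Suc (x + y))\<close>. As \<open>triangle\<close> is monotone, the bounds
  leave only one index.\<close>

lemma diag_index_prod_encode: "diag_index (prod_encode (x, y)) = x + y"
proof -
  have mono: "triangle i \<le> triangle j" if "i \<le> j" for i j
    using that by (induction rule: dec_induct) auto
  let ?z = "prod_encode (x, y)" let ?d = "diag_index ?z"
  have "\<not> ?d < x + y"
    using mono[of "Suc ?d" "x + y"] diag_index_bounds[of ?z] by (auto simp: prod_encode_def)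
  moreover have "\<not> x + y < ?d"
    using mono[of "Suc (x + y)" ?d] diag_index_bounds[of ?z] by (auto simp: prod_encode_def)
  ultimately show ?thesis by simp
qed

text \<open>Expresses decoding through operations that already have closure rules: the offset of
  \<open>z\<close> on its antidiagonal is the first component, and the index is the sum of
  both.\<close>

lemma prod_decode_eq:
  "fst (prod_decode z) = z - triangle (diag_index z)"
  "snd (prod_decode z) = diag_index z - (z - triangle (diag_index z))"
proof -
  obtain x y where "z = prod_encode (x, y)" by (metis prod_decode_inverse surj_pair)
  then show "fst (prod_decode z) = z - triangle (diag_index z)"
    "snd (prod_decode z) = diag_index z - (z - triangle (diag_index z))"
    by (simp_all add: diag_index_prod_encode) (simp_all add: prod_encode_def)
qed

lemma rf_diag_index [rf_intros]:
  assumes "recursive_fun n f"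
  shows "recursive_fun n (\<lambda>xs. diag_index (f xs))"
proof -
  have "recursive_fun n (\<lambda>xs. rec_nat 0 (\<lambda>i r. (i # r # xs) ! 1 +
      (1 - (triangle (Suc ((i # r # xs) ! 1)) - Suc ((i # r # xs) ! 0)))) (f xs))"
    by (rule rf_rec[where s = "\<lambda>xs. xs ! 1 + (1 - (triangle (Suc (xs ! 1)) - Suc (xs ! 0)))"])
      (intro rf_intros assms | simp)+
  then show ?thesis by (simp add: diag_index_def)
qed

lemma rf_prod_decode [rf_intros]:
  assumes "recursive_fun n f"
  shows "recursive_fun n (\<lambda>xs. fst (prod_decode (f xs)))"
    and "recursive_fun n (\<lambda>xs. snd (prod_decode (f xs)))"
  unfolding prod_decode_eq by (intro rf_intros assms)+

lemma rf_list_encode [rf_intros]: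
  "recursive_fun n f \<Longrightarrow> recursive_fun n (\<lambda>xs. list_encode (g xs)) \<Longrightarrow>
    recursive_fun n (\<lambda>xs. list_encode (f xs # g xs))"
  unfolding list_encode.simps by (intro rf_intros)

text \<open>The subtraction undoes the \<open>Suc\<close> that \<open>list_encode\<close> puts
  around the code of head and tail.\<close>

definition code_hd :: "nat \<Rightarrow> nat" where
  "code_hd z = fst (prod_decode (z - 1))"

definition code_tl :: "nat \<Rightarrow> nat" where
  "code_tl z = snd (prod_decode (z - 1))"

lemma code_hd_tl [simp]:
  "code_hd (list_encode (x # xs)) = x" "code_tl (list_encode (x # xs)) = list_encode xs"
  by (simp_all add: code_hd_def code_tl_def)

lemma rf_code_hd_tl [rf_intros]:
  assumes "recursive_fun n f"
  shows "recursive_fun n (\<lambda>xs. code_hd (f xs))" "recursive_fun n (\<lambda>xs. code_tl (f xs))"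
  unfolding code_hd_def code_tl_def by (intro rf_intros assms)+

text \<open>Integers are handled as differences of naturals. The representation need not be
  canonical: it is closed under ring operations, and \<open>int_encode\<close> can be computed from
  any such difference.\<close>

definition recursive_int_fun :: "nat \<Rightarrow> (nat list \<Rightarrow> int) \<Rightarrow> bool" where
  "recursive_int_fun n F \<longleftrightarrow>
     (\<exists>p q. recursive_fun n p \<and> recursive_fun n q \<and> (\<forall>xs. F xs = int (p xs) - int (q xs)))"

lemma rif_nat [rf_intros]: "recursive_fun n f \<Longrightarrow> recursive_int_fun n (\<lambda>xs. int (f xs))"
  unfolding recursive_int_fun_def by (intro exI[of _ f] exI[of _ "\<lambda>xs. 0"]) (simp add: rf_0)

lemma rif_0_1 [rf_intros]:
  "recursive_int_fun n (\<lambda>xs. 0)" "recursive_int_fun n (\<lambda>xs. 1)"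
  using rif_nat[OF rf_const[of n 0]] rif_nat[OF rf_const[of n 1]] by simp_all

lemma rif_diff [rf_intros]:
  assumes "recursive_int_fun n F" "recursive_int_fun n G"
  shows "recursive_int_fun n (\<lambda>xs. F xs - G xs)"
proof -
  obtain p q r s where "recursive_fun n p" "recursive_fun n q" "recursive_fun n r" "recursive_fun n s"
    and "\<And>xs. F xs = int (p xs) - int (q xs)" "\<And>xs. G xs = int (r xs) - int (s xs)"
    using assms unfolding recursive_int_fun_def by blast
  then show ?thesis unfolding recursive_int_fun_def
    by (intro exI[of _ "\<lambda>xs. p xs + s xs"] exI[of _ "\<lambda>xs. q xs + r xs"] conjI allI rf_intros) simp_all
qed

lemma rif_mult [rf_intros]:
  assumes "recursive_int_fun n F" "recursive_int_fun n G"
  shows "recursive_int_fun n (\<lambda>xs. F xs * G xs)"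
proof -
  obtain p q r s where "recursive_fun n p" "recursive_fun n q" "recursive_fun n r" "recursive_fun n s"
    and "\<And>xs. F xs = int (p xs) - int (q xs)" "\<And>xs. G xs = int (r xs) - int (s xs)"
    using assms unfolding recursive_int_fun_def by blast
  then show ?thesis unfolding recursive_int_fun_def
    by (intro exI[of _ "\<lambda>xs. p xs * r xs + q xs * s xs"] exI[of _ "\<lambda>xs. p xs * s xs + q xs * r xs"])
      (intro conjI allI rf_intros, simp_all only: of_nat_add of_nat_mult, simp_all add: algebra_simps)
qed

lemma rif_uminus [rf_intros]: "recursive_int_fun n F \<Longrightarrow> recursive_int_fun n (\<lambda>xs. - F xs)"
  using rif_diff[OF rif_0_1(1)] by simp

lemma rf_parity [rf_intros]:
  assumes "recursive_fun n f"
  shows "recursive_fun n (\<lambda>xs. f xs mod 2)"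
proof -
  have "recursive_fun n (\<lambda>xs. rec_nat 0 (\<lambda>i r. 1 - (i # r # xs) ! 1) (f xs))"
    by (rule rf_rec[where s = "\<lambda>xs. 1 - xs ! 1"]) (intro rf_intros assms | simp)+
  moreover have "rec_nat 0 (\<lambda>i r. Suc 0 - r) y = y mod 2" for y
    by (induction y) (auto simp: mod_Suc)
  ultimately show ?thesis by simp
qed

text \<open>\<open>y div 2\<close> is the number of odd numbers below \<open>y\<close>, which the
  recursion counts.\<close>

lemma rf_half [rf_intros]:
  assumes "recursive_fun n f"
  shows "recursive_fun n (\<lambda>xs. f xs div 2)"
proof -
  have "recursive_fun n (\<lambda>xs. rec_nat 0 (\<lambda>i r. (i # r # xs) ! 1 + (i # r # xs) ! 0 mod 2) (f xs))"
    by (rule rf_rec[where s = "\<lambda>xs. xs ! 1 + xs ! 0 mod 2"]) (intro rf_intros assms | simp)+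
  moreover have "rec_nat 0 (\<lambda>i r. r + i mod 2) y = y div 2" for y :: nat
    by (induction y) (auto, presburger)
  ultimately show ?thesis by simp
qed

lemma rif_int_decode [rf_intros]:
  assumes "recursive_fun n f"
  shows "recursive_int_fun n (\<lambda>xs. int_decode (f xs))"
proof -
  \<comment> \<open>An even code \<open>2 * k\<close> stands for \<open>k\<close>, an odd code
    \<open>2 * k + 1\<close> for \<open>- (k + 1)\<close>; the parity selects the branch.\<close>
  have "int_decode y = int ((1 - y mod 2) * (y div 2)) - int (y mod 2 * Suc (y div 2))" for y
    by (cases "even y") (auto simp: int_decode_def sum_decode_def odd_iff_mod_2_eq_one)
  then show ?thesis
    by (simp only:) (intro rf_intros assms)
qed

text \<open>Truncated subtraction makes at least one of the two summands below vanish.\<close>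

lemma int_encode_diff: "int_encode (int p - int q) = 2 * (p - q) + (2 * (q - p) - 1)"
proof (cases "q \<le> p")
  case True
  then show ?thesis by (simp add: int_encode_def sum_encode_def nat_diff_distrib)
next
  case False
  then have "nat (int q - int p - 1) = q - p - 1" by linarith
  then show ?thesis using False by (simp add: int_encode_def sum_encode_def)
qed

lemma rf_int_encode [rf_intros]:
  assumes "recursive_int_fun n F"
  shows "recursive_fun n (\<lambda>xs. int_encode (F xs))"
proof -
  obtain p q where pq: "recursive_fun n p" "recursive_fun n q" "\<And>xs. F xs = int (p xs) - int (q xs)"
    using assms unfolding recursive_int_fun_def by blast
  show ?thesis unfolding pq(3) int_encode_diff by (intro rf_intros pq)
qed

text \<open>An integer is in lowest terms with denominator 1, so no fraction has to be reduced. This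
  is why the reduction uses an integer threshold.\<close>

lemma rf_encode_rat_of_int [rf_intros]:
  assumes "recursive_int_fun n F"
  shows "recursive_fun n (\<lambda>xs. encode_rat (of_int (F xs)))"
proof -
  have "encode_rat (of_int i) = prod_encode (int_encode i, 1)" for i
    by (simp add: encode_rat_def)
  then show ?thesis by (simp only:) (intro rf_intros assms)
qed

definition code_num :: "nat \<Rightarrow> int" where
  "code_num z = int_decode (fst (prod_decode z))"

definition code_denom :: "nat \<Rightarrow> int" where
  "code_denom z = int (snd (prod_decode z))"

lemma code_encode_rat [simp]:
  "code_num (encode_rat r) = fst (quotient_of r)" "code_denom (encode_rat r) = snd (quotient_of r)"
  using quotient_of_denom_pos'[of r]
  by (simp_all add: code_num_def code_denom_def encode_rat_def case_prod_beta)

lemma rif_code_num_denom [rf_intros]: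
  assumes "recursive_fun n f"
  shows "recursive_int_fun n (\<lambda>xs. code_num (f xs))" "recursive_int_fun n (\<lambda>xs. code_denom (f xs))"
  unfolding code_num_def code_denom_def by (intro rf_intros assms)+


section \<open>Series with two digits\<close>

text \<open>A multiple of the geometric series dominates. The bound does not depend on
  \<open>u\<close>, which later keeps the remainders bounded.\<close>

lemma digit_series_summable:
  fixes l :: real
  assumes l: "0 < l" "l < 1" and u: "\<And>i. u i \<in> {x, y}"
  shows "summable (\<lambda>i. l ^ i * u i)"
    and "\<bar>\<Sum>i. l ^ i * u i\<bar> \<le> (\<bar>x\<bar> + \<bar>y\<bar>) / (1 - l)"
proof -
  have bound: "norm (l ^ i * u i) \<le> (\<bar>x\<bar> + \<bar>y\<bar>) * l ^ i" for i
  proof -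
    have "\<bar>u i\<bar> \<le> \<bar>x\<bar> + \<bar>y\<bar>" using u[of i] by auto
    then show ?thesis using l by (simp add: abs_mult mult.commute mult_right_mono)
  qed
  have geo: "(\<lambda>i. (\<bar>x\<bar> + \<bar>y\<bar>) * l ^ i) sums ((\<bar>x\<bar> + \<bar>y\<bar>) / (1 - l))"
    using sums_mult[OF geometric_sums[of l], of "\<bar>x\<bar> + \<bar>y\<bar>"] l by simp
  show "summable (\<lambda>i. l ^ i * u i)"
    by (rule summable_comparison_test[OF _ sums_summable[OF geo]]) (use bound in blast)
  show "\<bar>\<Sum>i. l ^ i * u i\<bar> \<le> (\<bar>x\<bar> + \<bar>y\<bar>) / (1 - l)"
    using norm_suminf_le[OF bound sums_summable[OF geo]] sums_unique[OF geo] by simp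
qed

text \<open>
  The set of values of such series is closed: if \<open>r\<close> is a limit of values, then for one of the
  digits \<open>d\<close> so is \<open>(r - d) / l\<close>, and reading off digits in this way gives a series with value \<open>r\<close>
  because the remainders stay bounded.
\<close>

lemma digit_series_closed:
  fixes l :: real
  assumes l: "0 < l" "l < 1"
    and approx: "\<And>e. e > 0 \<Longrightarrow> \<exists>u. (\<forall>i. u i \<in> {x, y}) \<and> \<bar>(\<Sum>i. l ^ i * u i) - s\<bar> < e"
  shows "\<exists>u. (\<forall>i. u i \<in> {x, y}) \<and> (\<lambda>i. l ^ i * u i) sums s"
proof -
  \<comment> \<open>\<open>good r\<close> says that \<open>r\<close> lies in the closure of the set
    of values.\<close>
  define good where
    "good r \<longleftrightarrow> (\<forall>e>0. \<exists>u. (\<forall>i. u i \<in> {x, y}) \<and> \<bar>(\<Sum>i. l ^ i * u i) - r\<bar> < e)" for r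
  have good_bound: "\<bar>r\<bar> \<le> (\<bar>x\<bar> + \<bar>y\<bar>) / (1 - l) + 1" if good: "good r" for r
  proof -
    obtain u where u: "\<forall>i. u i \<in> {x, y}" "\<bar>(\<Sum>i. l ^ i * u i) - r\<bar> < 1"
      using good[unfolded good_def, rule_format, of 1] by auto
    have "\<bar>\<Sum>i. l ^ i * u i\<bar> \<le> (\<bar>x\<bar> + \<bar>y\<bar>) / (1 - l)"
      by (rule digit_series_summable(2)[OF l]) (use u in blast)
    then show ?thesis using u(2) by linarith
  qed
  have good_step: "\<exists>d\<in>{x, y}. good ((r - d) / l)" if good: "good r" for r
  proof (rule ccontr)
    assume contr: "\<not> ?thesis"
    have far: "\<exists>e>0. \<forall>u. (\<forall>i. u i \<in> {x, y}) \<longrightarrow> e \<le> \<bar>(\<Sum>i. l ^ i * u i) - q\<bar>"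
      if "\<not> good q" for q
      using that unfolding good_def by (meson linorder_not_less)
    from contr have "\<not> good ((r - x) / l)" "\<not> good ((r - y) / l)" by simp_all
    note far = far[OF this(1)] far[OF this(2)]
    from far(1) obtain e where e: "e > 0"
      and far_x: "\<forall>u. (\<forall>i. u i \<in> {x, y}) \<longrightarrow> e \<le> \<bar>(\<Sum>i. l ^ i * u i) - (r - x) / l\<bar>"
      by (elim exE conjE)
    from far(2) obtain e' where e': "e' > 0"
      and far_y: "\<forall>u. (\<forall>i. u i \<in> {x, y}) \<longrightarrow> e' \<le> \<bar>(\<Sum>i. l ^ i * u i) - (r - y) / l\<bar>"
      by (elim exE conjE)
    \<comment> \<open>Take a value this close to \<open>r\<close> and strip its first digit
      \<open>u 0\<close>. The remaining tail is within \<open>min e e'\<close> of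
      \<open>(r - u 0) / l\<close>, against the choice of \<open>e\<close> and
      \<open>e'\<close>.\<close>
    have "l * min e e' > 0" using e e' l by simp
    then obtain u where u: "\<forall>i. u i \<in> {x, y}" and near: "\<bar>(\<Sum>i. l ^ i * u i) - r\<bar> < l * min e e'"
      using good unfolding good_def by blast
    have u': "\<forall>i. u (Suc i) \<in> {x, y}" using u by blast
    let ?S = "\<Sum>i. l ^ i * u (Suc i)"
    have "summable (\<lambda>i. l ^ i * u i)" "summable (\<lambda>i. l ^ i * u (Suc i))"
      by (rule digit_series_summable(1)[OF l, of _ x y], use u in blast)+
    from suminf_split_head[OF this(1)] suminf_mult[OF this(2), of l]
    have "(\<Sum>i. l ^ i * u i) = u 0 + l * ?S" by (simp add: mult.assoc)
    moreover have "l * ((r - u 0) / l) = r - u 0" using l by simp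
    ultimately have "(\<Sum>i. l ^ i * u i) - r = l * (?S - (r - u 0) / l)"
      unfolding right_diff_distrib by simp
    then have "\<bar>(\<Sum>i. l ^ i * u i) - r\<bar> = l * \<bar>?S - (r - u 0) / l\<bar>"
      using l by (simp only: abs_mult abs_of_pos)
    then have "\<bar>?S - (r - u 0) / l\<bar> < min e e'"
      using near l by (simp only: mult_less_cancel_left_pos)
    moreover have "u 0 = x \<or> u 0 = y" using u by simp
    ultimately show False using far_x[THEN spec, THEN mp, OF u'] far_y[THEN spec, THEN mp, OF u']
      by (elim disjE) simp_all
  qed
  obtain d where d: "\<And>r. good r \<Longrightarrow> d r \<in> {x, y} \<and> good ((r - d r) / l)"
    using good_step unfolding Bex_def by metis
  \<comment> \<open>The successive remainders of \<open>s\<close>; the digit read off at stage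
    \<open>n\<close> is \<open>d (R n)\<close>, and after \<open>n\<close> digits the partial sum
    misses \<open>s\<close> by \<open>l ^ n * R n\<close>.\<close>
  define R where "R = rec_nat s (\<lambda>_ r. (r - d r) / l)"
  have R: "R 0 = s" "\<And>n. R (Suc n) = (R n - d (R n)) / l" by (simp_all add: R_def)
  have good_R: "good (R n)" for n
  proof (induction n)
    case 0
    show ?case using approx by (simp add: good_def R)
  next
    case (Suc n)
    then show ?case using d by (simp add: R)
  qed
  have partial: "(\<Sum>i<n. l ^ i * d (R i)) = s - l ^ n * R n" for n
  proof (induction n)
    case (Suc n)
    have "l ^ Suc n * R (Suc n) = l ^ n * (R n - d (R n))" using l by (simp add: R)
    then show ?case using Suc by (simp add: right_diff_distrib)
  qed (simp add: R)
  have "(\<lambda>n. l ^ n * R n) \<longlonglongrightarrow> 0"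
  proof (rule tendsto_0_le)
    show "(\<lambda>n. l ^ n) \<longlonglongrightarrow> 0" using l by (intro LIMSEQ_power_zero) simp
    show "\<forall>\<^sub>F n in sequentially.
        norm (l ^ n * R n) \<le> norm (l ^ n) * ((\<bar>x\<bar> + \<bar>y\<bar>) / (1 - l) + 1)"
      using good_bound[OF good_R] l by (simp add: abs_mult mult_left_mono)
  qed
  then have "(\<lambda>n. s - l ^ n * R n) \<longlonglongrightarrow> s"
    using tendsto_diff[OF tendsto_const[of s]] by fastforce
  then have "(\<lambda>i. l ^ i * d (R i)) sums s"
    by (simp add: sums_def partial)
  moreover have "\<forall>i. d (R i) \<in> {x, y}" using d[OF good_R] by simp
  ultimately show ?thesis by (intro exI[of _ "\<lambda>i. d (R i)"] conjI)
qed


section \<open>The game\<close>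

lemma Out_props:
  assumes "valid_arena A" "v \<in> verts A" "\<sigma>0 \<in> strategies A Player0" "\<sigma>1 \<in> strategies A Player1"
  shows "Out A v \<sigma>0 \<sigma>1 \<in> plays A" "Out A v \<sigma>0 \<sigma>1 0 = v"
    "consistent A Player0 \<sigma>0 (Out A v \<sigma>0 \<sigma>1)" "consistent A Player1 \<sigma>1 (Out A v \<sigma>0 \<sigma>1)"
  using theI'[OF Out_ex1[OF assms]] unfolding Out_def by auto

lemma Out_eqI:
  assumes "valid_arena A" "v \<in> verts A" "\<sigma>0 \<in> strategies A Player0" "\<sigma>1 \<in> strategies A Player1"
    and "\<pi> \<in> plays A" "\<pi> 0 = v" "consistent A Player0 \<sigma>0 \<pi>" "consistent A Player1 \<sigma>1 \<pi>"
  shows "Out A v \<sigma>0 \<sigma>1 = \<pi>"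
  unfolding Out_def by (rule the1_equality[OF Out_ex1[OF assms(1-4)]]) (use assms in simp)

text \<open>
  Player 1 only moves at vertex 0, where he may leave to the sink 1 with payoff \<open>- C\<close>. Vertices 2
  and 3 belong to Player 0; an edge into them emits the digit \<open>A\<close>, respectively \<open>B\<close>.
\<close>

definition target_game :: "int \<Rightarrow> int \<Rightarrow> int \<Rightarrow> rat \<Rightarrow> ds_game" where
  "target_game A B C lam =
     \<lparr> owners = [Player1, Player0, Player0, Player0],
       edge_wts = [((0, 1), (C - 1, - C)), ((0, 2), (0, 0)), ((1, 1), (0, 0)),
                   ((2, 2), (A, - A)), ((2, 3), (B, - B)), ((3, 2), (A, - A)), ((3, 3), (B, - B))],
       discount = lam \<rparr>"

locale target_arena =
  fixes A B C :: int and lam :: rat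
  assumes lam: "0 < lam" "lam < 1"
begin

definition l :: real where "l = of_rat lam"

definition Ar :: "nat arena" where "Ar = arena_of (target_game A B C lam)"

lemma l: "0 < l" "l < 1"
  using lam by (simp_all add: l_def)

lemma edges_iff: "(u, v) \<in> edges Ar \<longleftrightarrow>
    u = 0 \<and> (v = 1 \<or> v = 2) \<or> u = 1 \<and> v = 1 \<or> (u = 2 \<or> u = 3) \<and> (v = 2 \<or> v = 3)"
  by (auto simp: Ar_def arena_of_def target_game_def)

lemma own_iff: "u \<in> own Ar Player0 \<longleftrightarrow> u \<in> {1, 2, 3}" "u \<in> own Ar Player1 \<longleftrightarrow> u = 0"
  by (auto simp: Ar_def arena_of_def target_game_def less_Suc_eq numeral_eq_Suc)

lemma verts_iff: "u \<in> verts Ar \<longleftrightarrow> u \<in> {0, 1, 2, 3}"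
  by (auto simp: Ar_def arena_of_def target_game_def)

lemma wt_simps:
  "wt Ar Player0 (0, 1) = C - 1" "wt Ar Player1 (0, 1) = - C" "wt Ar i (0, 2) = 0" "wt Ar i (1, 1) = 0"
  "u \<in> {2, 3} \<Longrightarrow> wt Ar Player0 (u, 2) = A" "u \<in> {2, 3} \<Longrightarrow> wt Ar Player0 (u, 3) = B"
  "u \<in> {2, 3} \<Longrightarrow> wt Ar Player1 (u, 2) = - A" "u \<in> {2, 3} \<Longrightarrow> wt Ar Player1 (u, 3) = - B"
  by (auto simp: Ar_def arena_of_def target_game_def split: player.split)

lemma valid_Ar: "valid_arena Ar"
proof -
  have "\<exists>v. (u, v) \<in> edges Ar" if "u \<in> verts Ar" for u
    using that unfolding edges_iff verts_iff by auto
  moreover have "finite (verts Ar)" by (simp add: Ar_def arena_of_def)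
  moreover have "edges Ar \<subseteq> verts Ar \<times> verts Ar" by (auto simp: edges_iff verts_iff)
  moreover have "own Ar Player0 \<union> own Ar Player1 = verts Ar" "own Ar Player0 \<inter> own Ar Player1 = {}"
    by (auto simp: own_iff verts_iff)
  ultimately show ?thesis by (simp add: valid_arena_def)
qed

lemma valid_target_game: "valid_game (target_game A B C lam)"
  using valid_Ar lam by (simp add: valid_game_def Ar_def) (simp add: target_game_def)

lemma plays_edge: "\<pi> \<in> plays Ar \<Longrightarrow> (\<pi> k, \<pi> (Suc k)) \<in> edges Ar"
  by (simp add: plays_def)

section \<open>Payoffs of plays from vertex 0\<close>

lemma DS_exit:
  assumes \<pi>: "\<pi> \<in> plays Ar" "\<pi> 0 = 0" "\<pi> (Suc 0) = 1"
  shows "DS Ar l Player0 \<pi> = C - 1" "DS Ar l Player1 \<pi> = - C"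
proof -
  have tail: "\<pi> (Suc k) = 1" for k
  proof (induction k)
    case 0
    show ?case using \<pi> by simp
  next
    case (Suc k)
    then show ?case using plays_edge[OF \<pi>(1), of "Suc k"] by (simp add: edges_iff)
  qed
  have "DS Ar l i \<pi> = wt Ar i (0, 1)" for i
  proof -
    have "wt Ar i (\<pi> k, \<pi> (Suc k)) = 0" if "k \<noteq> 0" for k
      using that wt_simps(4) tail by (cases k) auto
    then have "(\<Sum>k. l ^ k * of_int (wt Ar i (\<pi> k, \<pi> (Suc k)))) =
        (\<Sum>k\<in>{0}. l ^ k * of_int (wt Ar i (\<pi> k, \<pi> (Suc k))))"
      by (intro suminf_finite) auto
    then show ?thesis using \<pi> by (simp add: DS_def)
  qed
  then show "DS Ar l Player0 \<pi> = C - 1" "DS Ar l Player1 \<pi> = - C"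
    using wt_simps(1,2) by simp_all
qed

text \<open>Positions 0 and 1 of an entering play are the vertices 0 and 2, and the edge between
  them has weight 0. The first digit is therefore shown by the vertex at position 2.\<close>

definition digits :: "(nat \<Rightarrow> nat) \<Rightarrow> nat \<Rightarrow> real" where
  "digits \<pi> k = (if \<pi> (Suc (Suc k)) = 2 then of_int A else of_int B)"

lemma DS_enter:
  assumes \<pi>: "\<pi> \<in> plays Ar" "\<pi> 0 = 0" "\<pi> (Suc 0) = 2"
  shows "DS Ar l Player0 \<pi> = l * (\<Sum>i. l ^ i * digits \<pi> i)"
    and "DS Ar l Player1 \<pi> = - DS Ar l Player0 \<pi>"
proof -
  have tail: "\<pi> (Suc k) \<in> {2, 3}" for k
  proof (induction k)
    case 0
    show ?case using \<pi> by simp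
  next
    case (Suc k)
    then show ?case using plays_edge[OF \<pi>(1), of "Suc k"] by (auto simp: edges_iff)
  qed
  have w: "wt Ar Player0 (\<pi> (Suc k), \<pi> (Suc (Suc k))) = digits \<pi> k"
    "wt Ar Player1 (\<pi> (Suc k), \<pi> (Suc (Suc k))) = - digits \<pi> k" for k
    using tail[of k] tail[of "Suc k"] wt_simps(5-8)[of "\<pi> (Suc k)"] by (auto simp: digits_def)
  have "summable (\<lambda>i. l ^ i * digits \<pi> i)"
    by (rule digit_series_summable(1)[OF l, of _ "of_int A" "of_int B"]) (simp add: digits_def)
  then have s: "(\<lambda>i. l * (l ^ i * digits \<pi> i)) sums (l * (\<Sum>i. l ^ i * digits \<pi> i))"
    by (intro sums_mult summable_sums)
  have "(\<lambda>k. l ^ Suc k * wt Ar Player0 (\<pi> (Suc k), \<pi> (Suc (Suc k)))) sums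
      (l * (\<Sum>i. l ^ i * digits \<pi> i))"
    using s by (simp add: w mult.assoc)
  from sums_Suc[OF this] show 0: "DS Ar l Player0 \<pi> = l * (\<Sum>i. l ^ i * digits \<pi> i)"
    using \<pi> wt_simps(3) by (simp add: DS_def sums_iff)
  have "(\<lambda>k. l ^ Suc k * wt Ar Player1 (\<pi> (Suc k), \<pi> (Suc (Suc k)))) sums
      - (l * (\<Sum>i. l ^ i * digits \<pi> i))"
    using sums_minus[OF s] by (simp add: w mult.assoc)
  from sums_Suc[OF this] show "DS Ar l Player1 \<pi> = - DS Ar l Player0 \<pi>"
    using \<pi> wt_simps(3) unfolding 0 by (simp add: DS_def sums_iff)
qed

text \<open>Player 1 owns only vertex 0, whose successors are 1 and 2, so a constant choice is
  always legal.\<close>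

lemma const_strategy: "v = 1 \<or> v = 2 \<Longrightarrow> (\<lambda>_. v) \<in> strategies Ar Player1"
  by (auto simp: strategies_def own_iff edges_iff)

lemma play_from_0: "\<pi> \<in> plays Ar \<Longrightarrow> \<pi> 0 = 0 \<Longrightarrow> \<pi> (Suc 0) = 1 \<or> \<pi> (Suc 0) = 2"
  using plays_edge[of \<pi> 0] by (simp add: edges_iff)

text \<open>Leaving secures \<open>- C\<close> for Player 1, so a best response yields him at least
  that. If he enters, the payoffs are opposite, so Player 0 gets at most \<open>C\<close>.\<close>

lemma best_response_payoff:
  assumes \<sigma>0: "\<sigma>0 \<in> strategies Ar Player0" and \<sigma>1: "\<sigma>1 \<in> BR1 Ar l \<sigma>0"
  defines "x \<equiv> DS Ar l Player0 (Out Ar 0 \<sigma>0 \<sigma>1)"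
  shows "x = C - 1 \<or>
    x \<le> C \<and> (\<exists>u. (\<forall>i. u i \<in> {of_int A, of_int B}) \<and> x = l * (\<Sum>i. l ^ i * u i))"
proof -
  have \<sigma>1': "\<sigma>1 \<in> strategies Ar Player1" using \<sigma>1 by (simp add: BR1_def)
  have v: "0 \<in> verts Ar" by (simp add: verts_iff)
  note P = Out_props[OF valid_Ar v \<sigma>0 \<sigma>1']
  have c1: "(\<lambda>_. 1) \<in> strategies Ar Player1" by (rule const_strategy) simp
  note Q = Out_props[OF valid_Ar v \<sigma>0 c1]
  have "Out Ar 0 \<sigma>0 (\<lambda>_. 1) (Suc 0) = 1"
    using Q(2,4) by (simp add: consistent_def own_iff)
  then have "DS Ar l Player1 (Out Ar 0 \<sigma>0 (\<lambda>_. 1)) = - C"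
    by (rule DS_exit(2)[OF Q(1,2)])
  then have le: "- C \<le> DS Ar l Player1 (Out Ar 0 \<sigma>0 \<sigma>1)"
    using \<sigma>1 v c1 by (force simp: BR1_def)
  show ?thesis using play_from_0[OF P(1,2)]
  proof
    assume "Out Ar 0 \<sigma>0 \<sigma>1 (Suc 0) = 1"
    then show ?thesis using DS_exit(1)[OF P(1,2)] by (simp add: x_def)
  next
    assume "Out Ar 0 \<sigma>0 \<sigma>1 (Suc 0) = 2"
    note E = DS_enter[OF P(1,2) this]
    have "digits (Out Ar 0 \<sigma>0 \<sigma>1) i \<in> {of_int A, of_int B}" for i by (simp add: digits_def)
    then show ?thesis using E le unfolding x_def by auto
  qed
qed

lemma CSV_geD:
  assumes "CSV Ar l 0 \<ge> ereal (of_int C)"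
  shows "\<exists>u. (\<forall>i. u i \<in> {of_int A, of_int B}) \<and> (\<lambda>i. l ^ i * u i) sums (C / l)"
proof (rule digit_series_closed[OF l])
  fix e :: real assume e: "e > 0"
  \<comment> \<open>The bound 1 excludes the exit payoff \<open>C - 1\<close>; the bound
    \<open>l * e\<close> becomes \<open>e\<close> after the factor \<open>l\<close> of the entering
    round is divided out.\<close>
  define e' where "e' = min 1 (l * e)"
  have e': "e' > 0" "e' \<le> 1" "e' \<le> l * e" using e l by (auto simp: e'_def)
  have "ereal (C - e') < CSV Ar l 0"
    by (rule less_le_trans[OF _ assms]) (use e' in simp)
  then obtain \<sigma>0 \<sigma>1 where \<sigma>: "\<sigma>0 \<in> strategies Ar Player0" "\<sigma>1 \<in> BR1 Ar l \<sigma>0"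
    and gt: "C - e' < DS Ar l Player0 (Out Ar 0 \<sigma>0 \<sigma>1)"
    by (auto simp: CSV_def CSV_strat_def less_SUP_iff)
  obtain u where u: "\<forall>i. u i \<in> {of_int A, of_int B}"
    and "l * (\<Sum>i. l ^ i * u i) \<le> C" "C - e' < l * (\<Sum>i. l ^ i * u i)"
    using best_response_payoff[OF \<sigma>] gt e' by force
  then have "\<bar>l * ((\<Sum>i. l ^ i * u i) - C / l)\<bar> < l * e"
    using e' e l by (simp add: right_diff_distrib)
  then have "\<bar>(\<Sum>i. l ^ i * u i) - C / l\<bar> < e"
    using l by (simp add: abs_mult)
  then show "\<exists>u. (\<forall>i. u i \<in> {of_int A, of_int B}) \<and> \<bar>(\<Sum>i. l ^ i * u i) - C / l\<bar> < e"
    using u by blast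
qed

text \<open>
  Player 0 emits the digits \<open>u\<close>. Then Player 1 is indifferent at vertex 0, so entering is a best
  response.
\<close>

lemma CSV_geI:
  assumes u: "\<forall>i. u i \<in> {of_int A, of_int B}" and s: "(\<lambda>i. l ^ i * u i) sums (C / l)"
  shows "CSV Ar l 0 \<ge> ereal (of_int C)"
proof -
  \<comment> \<open>A history of length \<open>k + 1\<close> ends at position \<open>k\<close>, and
    the move to position \<open>k + 1\<close> emits digit \<open>k - 1\<close>, hence the offset 2.
    At the sink the loop is the only legal move.\<close>
  define \<sigma>0 where "\<sigma>0 h = (if last h = (1::nat) then 1::nat
      else if u (length h - 2) = of_int A then 2 else 3)" for h
  define \<rho> where "\<rho> k = (if k = 0 then 0 else if k = 1 then 2
      else if u (k - 2) = of_int A then 2 else 3 :: nat)" for k :: nat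
  have \<sigma>0: "\<sigma>0 \<in> strategies Ar Player0"
    by (auto simp: strategies_def own_iff edges_iff \<sigma>0_def)
  have c2: "(\<lambda>_. 2) \<in> strategies Ar Player1" by (rule const_strategy) simp
  have v: "0 \<in> verts Ar" by (simp add: verts_iff)
  have \<rho>_play: "\<rho> \<in> plays Ar" by (auto simp: plays_def edges_iff \<rho>_def)
  have out: "Out Ar 0 \<sigma>0 (\<lambda>_. 2) = \<rho>"
  proof (rule Out_eqI[OF valid_Ar v \<sigma>0 c2 \<rho>_play])
    show "\<rho> 0 = 0" by (simp add: \<rho>_def)
    show "consistent Ar Player1 (\<lambda>_. 2) \<rho>" by (auto simp: consistent_def own_iff \<rho>_def)
    have "\<rho> k \<noteq> 1" for k by (simp add: \<rho>_def)
    moreover have "\<rho> k \<in> own Ar Player0 \<Longrightarrow> k \<noteq> 0" for k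
      by (cases k) (simp_all add: \<rho>_def own_iff)
    ultimately show "consistent Ar Player0 \<sigma>0 \<rho>"
      by (auto simp: consistent_def \<sigma>0_def) (auto simp: \<rho>_def)
  qed
  have "digits \<rho> = u" using u by (fastforce simp: digits_def \<rho>_def)
  moreover have "(\<Sum>i. l ^ i * u i) = C / l" using s by (simp add: sums_iff)
  moreover have \<rho>1: "\<rho> 0 = 0" "\<rho> (Suc 0) = 2" by (simp_all add: \<rho>_def)
  ultimately have DS: "DS Ar l Player0 \<rho> = C" "DS Ar l Player1 \<rho> = - C"
    using DS_enter[OF \<rho>_play \<rho>1] l by simp_all
  \<comment> \<open>A best response must be optimal from every vertex. Leaving from 0 yields
    \<open>- C\<close>, exactly the payoff of \<open>\<rho>\<close>. As no edge leads into 0, any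
    other strategy of Player 1 that does not leave produces the same play as the constant 2.\<close>
  have "(\<lambda>_. 2) \<in> BR1 Ar l \<sigma>0"
    unfolding BR1_def
  proof (intro CollectI conjI ballI c2)
    fix w \<sigma>1 assume w: "w \<in> verts Ar" and \<sigma>1: "\<sigma>1 \<in> strategies Ar Player1"
    note P = Out_props[OF valid_Ar w \<sigma>0 \<sigma>1]
    show "DS Ar l Player1 (Out Ar w \<sigma>0 \<sigma>1) \<le> DS Ar l Player1 (Out Ar w \<sigma>0 (\<lambda>_. 2))"
    proof (cases "w = 0")
      case True
      note P = P[unfolded True]
      show ?thesis using play_from_0[OF P(1,2)]
      proof
        assume "Out Ar 0 \<sigma>0 \<sigma>1 (Suc 0) = 1"
        then show ?thesis using DS_exit(2)[OF P(1,2)] DS out True by simp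
      next
        assume 2: "Out Ar 0 \<sigma>0 \<sigma>1 (Suc 0) = 2"
        have "Out Ar 0 \<sigma>0 \<sigma>1 k \<noteq> 0" if "k \<noteq> 0" for k
          using that plays_edge[OF P(1), of "k - 1"] by (cases k) (auto simp: edges_iff)
        then have "consistent Ar Player1 (\<lambda>_. 2) (Out Ar 0 \<sigma>0 \<sigma>1)"
          using 2 unfolding consistent_def own_iff by metis
        then show ?thesis using Out_eqI[OF valid_Ar v \<sigma>0 c2 P(1,2,3)] True by simp
      qed
    next
      case False
      have "Out Ar w \<sigma>0 \<sigma>1 k \<noteq> 0" for k
        using False P(2) plays_edge[OF P(1), of "k - 1"] by (cases k) (auto simp: edges_iff)
      then have "consistent Ar Player1 (\<lambda>_. 2) (Out Ar w \<sigma>0 \<sigma>1)"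
        unfolding consistent_def own_iff by blast
      then show ?thesis using Out_eqI[OF valid_Ar w \<sigma>0 c2 P(1,2,3)] by simp
    qed
  qed
  then have "ereal (of_int C) \<le> CSV_strat Ar l \<sigma>0 0"
    unfolding CSV_strat_def by (rule SUP_upper2) (simp add: out DS)
  then show ?thesis unfolding CSV_def by (rule SUP_upper2[OF \<sigma>0])
qed

lemma target_game_instance: "(target_game A B C lam, 0, of_int C) \<in> csv_instances"
  using valid_target_game verts_iff[of 0] by (simp add: csv_instances_def Ar_def)

lemma csv_positive_target_game:
  "csv_positive (target_game A B C lam, 0, of_int C) \<longleftrightarrow>
     (\<exists>u. (\<forall>i. u i \<in> {of_int A, of_int B}) \<and>
       (\<lambda>i. of_rat lam ^ i * u i) sums (C / of_rat lam))"
proof -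
  have "csv_positive (target_game A B C lam, 0, of_int C) \<longleftrightarrow> CSV Ar l 0 \<ge> ereal (of_int C)"
    by (simp add: csv_positive_def Ar_def l_def) (simp add: target_game_def)
  then show ?thesis using CSV_geD CSV_geI unfolding l_def by blast
qed

end


section \<open>The reduction\<close>

definition num :: "rat \<Rightarrow> int" where "num r = fst (quotient_of r)"

definition denom :: "rat \<Rightarrow> int" where "denom r = snd (quotient_of r)"

lemma denom_pos: "denom r > 0"
  by (simp add: denom_def quotient_of_denom_pos')

lemma of_rat_eq_num_denom: "(of_rat r :: real) = num r / denom r"
proof -
  have "r = of_int (num r) / of_int (denom r)"
    unfolding num_def denom_def by (rule quotient_of_div) simp
  then show ?thesis by (metis of_rat_divide of_rat_of_int_eq)
qed

text \<open>
  All numbers are multiplied by the product of the denominators, and \<open>t\<close> also by \<open>lam\<close> because the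
  first digit is emitted in the second round.
\<close>

definition reduction :: "target_instance \<Rightarrow> csv_instance" where
  "reduction = (\<lambda>(a, b, t, lam).
     let C = num lam * num t * denom a * denom b
     in (target_game (num a * denom b * denom t * denom lam) (num b * denom a * denom t * denom lam)
           C lam, 0, of_int C))"

lemma reduction_correct:
  assumes "0 < lam" "lam < 1"
  shows "reduction (a, b, t, lam) \<in> csv_instances"
    and "target_positive (a, b, t, lam) \<longleftrightarrow> csv_positive (reduction (a, b, t, lam))"
proof -
  define A where "A = num a * denom b * denom t * denom lam"
  define B where "B = num b * denom a * denom t * denom lam"
  define C where "C = num lam * num t * denom a * denom b"
  define D :: real where "D = denom a * denom b * denom t * denom lam"
  define l :: real where "l = of_rat lam"
  have l: "l > 0" using assms by (simp add: l_def)
  note arena = target_arena.intro[OF assms]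
  have red: "reduction (a, b, t, lam) = (target_game A B C lam, 0, of_int C)"
    by (simp add: reduction_def A_def B_def C_def Let_def)
  show "reduction (a, b, t, lam) \<in> csv_instances"
    unfolding red by (rule target_arena.target_game_instance[OF arena])
  have pos: "denom r \<noteq> 0" for r using denom_pos[of r] by simp
  have D: "D \<noteq> 0" by (simp add: D_def pos)
  have num_lam: "num lam \<noteq> 0" using l by (auto simp: l_def of_rat_eq_num_denom)
  \<comment> \<open>\<open>D\<close> clears all denominators. Multiplying by this nonzero number
    turns words over \<open>a\<close>, \<open>b\<close> with value \<open>t\<close> into words over
    \<open>A\<close>, \<open>B\<close> with value \<open>C / l\<close>, and back.\<close>
  have scaled: "of_int A = D * of_rat a" "of_int B = D * of_rat b" "C / l = D * of_rat t"
    using l pos num_lam by (simp_all add: A_def B_def C_def D_def l_def of_rat_eq_num_denom field_simps)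
  have "target_positive (a, b, t, lam) \<longleftrightarrow>
      (\<exists>u. (\<forall>i. u i \<in> {of_int A, of_int B}) \<and> (\<lambda>i. l ^ i * u i) sums (C / l))"
  proof
    assume "target_positive (a, b, t, lam)"
    then obtain w where w: "\<forall>i. w i \<in> {a, b}" "(\<lambda>i. of_rat (w i) * l ^ i) sums (of_rat t)"
      by (auto simp: target_positive_def l_def)
    from w(1) have "\<forall>i. D * of_rat (w i) \<in> {of_int A, of_int B}" by (fastforce simp: scaled)
    moreover have "(\<lambda>i. l ^ i * (D * of_rat (w i))) sums (C / l)"
      using sums_mult[OF w(2), of D] by (simp add: scaled mult_ac)
    ultimately show "\<exists>u. (\<forall>i. u i \<in> {of_int A, of_int B}) \<and> (\<lambda>i. l ^ i * u i) sums (C / l)"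
      by (intro exI[of _ "\<lambda>i. D * of_rat (w i)"]) simp
  next
    assume "\<exists>u. (\<forall>i. u i \<in> {of_int A, of_int B}) \<and> (\<lambda>i. l ^ i * u i) sums (C / l)"
    then obtain u where u: "\<And>i. u i \<in> {D * of_rat a, D * of_rat b}"
      "(\<lambda>i. l ^ i * u i) sums (D * of_rat t)" by (auto simp: scaled)
    \<comment> \<open>The game yields a series of real digits; a rational letter is chosen for each
      of them.\<close>
    have "\<exists>w\<in>{a, b}. u i = D * of_rat w" for i using u(1)[of i] by blast
    then obtain w where w: "\<And>i. w i \<in> {a, b}" "\<And>i. u i = D * of_rat (w i)" by metis
    have "(\<lambda>i. D * (of_rat (w i) * l ^ i)) sums (D * of_rat t)"
      using u(2) by (simp add: w(2) mult_ac)
    then have "(\<lambda>i. of_rat (w i) * l ^ i) sums (of_rat t)"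
      using D by (simp add: sums_mult_iff)
    then show "target_positive (a, b, t, lam)"
      using w(1) by (auto simp: target_positive_def l_def)
  qed
  then show "target_positive (a, b, t, lam) \<longleftrightarrow> csv_positive (reduction (a, b, t, lam))"
    unfolding red target_arena.csv_positive_target_game[OF arena] l_def .
qed

section \<open>Computability of the reduction\<close>

definition game_code :: "int \<Rightarrow> int \<Rightarrow> int \<Rightarrow> nat \<Rightarrow> nat" where
  "game_code A B C lam = list_encode
     [list_encode
       [list_encode [1, 0, 0, 0],
        list_encode
         [list_encode [0, 1, int_encode (C - 1), int_encode (- C)],
          list_encode [0, 2, int_encode 0, int_encode 0],
          list_encode [1, 1, int_encode 0, int_encode 0],
          list_encode [2, 2, int_encode A, int_encode (- A)],
          list_encode [2, 3, int_encode B, int_encode (- B)],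
          list_encode [3, 2, int_encode A, int_encode (- A)],
          list_encode [3, 3, int_encode B, int_encode (- B)]],
        lam],
      0, encode_rat (of_int C)]"

text \<open>The discount factor enters only through its code, so the program copies that part of its
  input unchanged.\<close>

lemma encode_csv_target_game:
  "encode_csv (target_game A B C lam, 0, of_int C) = game_code A B C (encode_rat lam)"
  unfolding encode_csv_def prod.case encode_game_def target_game_def game_code_def encode_edge_def
    encode_player_def ds_game.select_convs list.map player.case ..

lemma rf_game_code [rf_intros]:
  assumes "recursive_int_fun n A" "recursive_int_fun n B" "recursive_int_fun n C"
    and "recursive_fun n f"
  shows "recursive_fun n (\<lambda>xs. game_code (A xs) (B xs) (C xs) (f xs))"
  unfolding game_code_def by (intro rf_intros assms)

lemma reduction_computable: "computable_on target_instances encode_target encode_csv reduction"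
proof -
  \<comment> \<open>The components 0 to 3 of an encoded instance are \<open>a\<close>,
    \<open>b\<close>, \<open>t\<close> and \<open>lam\<close>; iterating \<open>code_tl\<close>
    reaches component \<open>i\<close>.\<close>
  define num' where "num' i z = code_num (code_hd ((code_tl ^^ i) z))" for i z
  define denom' where "denom' i z = code_denom (code_hd ((code_tl ^^ i) z))" for i z
  define F where "F z = game_code
      (num' 0 z * denom' 1 z * denom' 2 z * denom' 3 z) (num' 1 z * denom' 0 z * denom' 2 z * denom' 3 z)
      (num' 3 z * num' 2 z * denom' 0 z * denom' 1 z) (code_hd ((code_tl ^^ 3) z))" for z
  have F: "encode_csv (reduction I) = F (encode_target I)" for I
    by (cases I) (simp add: F_def num'_def denom'_def encode_target_def reduction_def Let_def
        encode_csv_target_game num_def denom_def numeral_eq_Suc del: list_encode.simps of_int_mult)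
  have tl: "recursive_fun n (\<lambda>xs. (code_tl ^^ i) (f xs))" if "recursive_fun n f" for i n f
    by (induction i) (use that in \<open>auto intro: rf_code_hd_tl\<close>)
  have "recursive_fun 1 (\<lambda>xs. F (xs ! 0))"
    unfolding F_def num'_def denom'_def by (intro rf_intros tl) simp_all
  then obtain p where p: "\<forall>xs. length xs = 1 \<longrightarrow> computes p xs (F (xs ! 0))"
    unfolding recursive_fun_def ..
  have "computes p [z] (F z)" for z using p[rule_format, of "[z]"] by simp
  then show ?thesis unfolding computable_on_def F by blast
qed

theorem lemma15:
  shows "\<exists>f :: target_instance \<Rightarrow> csv_instance.
           computable_on target_instances encode_target encode_csv f \<and>
           (\<forall>I\<in>target_instances.
              f I \<in> csv_instances \<and> (target_positive I \<longleftrightarrow> csv_positive (f I)))"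
proof (intro exI[of _ reduction] conjI ballI)
  fix I assume "I \<in> target_instances"
  then obtain a b t lam where I: "I = (a, b, t, lam)" and "0 < lam" "lam < 1"
    by (auto simp: target_instances_def)
  then show "reduction I \<in> csv_instances" "target_positive I \<longleftrightarrow> csv_positive (reduction I)"
    using reduction_correct by blast+
qed (rule reduction_computable)

end
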